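(* Let $X$ be a Tychonoff space. Then $C_p(X)$ is von Neumann complete if and only if $X$ is discrete.
   Context: $\mathbb{F}$ denotes $\mathbb{R}$ or $\mathbb{C}$. A Tychonoff space is a completely regular $T_1$ space. $C_p(X)$ is the vector space of all continuous $\mathbb{F}$-valued functions on $X$ endowed with the topology of pointwise convergence. A subset $A$ of a topological vector space $E$ is precompact if for every neighborhood $U$ of zero there is a finite set $F\subseteq E$ with $A\subseteq F+U$. A locally convex space $E$ is von Neumann complete if every precompact subset of $E$ is relatively compact (i.e. has compact closure in $E$). *)

theory Defs
  imports "HOL-Analysis.Analysis" "HOL-Library.Function_Algebras"
begin

definition Tychonoff_space :: "'a topology \<Rightarrow> bool" where
  "Tychonoff_space X \<longleftrightarrow> completely_regular_space X \<and> t1_space X"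

text \<open>
  A topological vector space is a topology whose underlying set is a linear subspace of an
  ambient vector space; only the operations restricted to that subspace have to be continuous.
\<close>

locale topological_vector_space = vector_space scale
  for scale :: "'k::real_normed_field \<Rightarrow> 'v::ab_group_add \<Rightarrow> 'v" +
  fixes E :: "'v topology"
  assumes subspace_topspace: "subspace (topspace E)"
    and continuous_add: "continuous_map (prod_topology E E) E (\<lambda>(x, y). x + y)"
    and continuous_scale: "continuous_map (prod_topology euclidean E) E (\<lambda>(c, x). scale c x)"

definition nhd_zero :: "'v::zero topology \<Rightarrow> 'v set \<Rightarrow> bool" where
  "nhd_zero E U \<longleftrightarrow> U \<subseteq> topspace E \<and> (\<exists>V. openin E V \<and> 0 \<in> V \<and> V \<subseteq> U)"

locale locally_convex_space = topological_vector_space scale E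
  for scale :: "'k::real_normed_field \<Rightarrow> 'v::ab_group_add \<Rightarrow> 'v" and E :: "'v topology" +
  assumes convex_nhd: "nhd_zero E U \<Longrightarrow>
    \<exists>C. nhd_zero E C \<and> C \<subseteq> U \<and>
      (\<forall>x\<in>C. \<forall>y\<in>C. \<forall>t\<in>{0..1}. scale (of_real (1 - t)) x + scale (of_real t) y \<in> C)"

definition precompact_in :: "'v::ab_group_add topology \<Rightarrow> 'v set \<Rightarrow> bool" where
  "precompact_in E A \<longleftrightarrow> A \<subseteq> topspace E \<and>
    (\<forall>U. nhd_zero E U \<longrightarrow>
      (\<exists>F. finite F \<and> F \<subseteq> topspace E \<and> A \<subseteq> {f + u | f u. f \<in> F \<and> u \<in> U}))"

definition von_Neumann_complete :: "'v::ab_group_add topology \<Rightarrow> bool" where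
  "von_Neumann_complete E \<longleftrightarrow> (\<forall>A. precompact_in E A \<longrightarrow> compactin E (E closure_of A))"

text \<open>
  A function on \<open>topspace X\<close> is represented by the total function extending it by \<open>0\<close>, so that the
  pointwise operations of the function type are those of the space. Since the extra coordinates
  are constantly \<open>0\<close>, the topology induced by the product topology over the whole type is that
  of pointwise convergence on \<open>topspace X\<close>.
\<close>

definition Cp :: "'a topology \<Rightarrow> ('a \<Rightarrow> 'k::real_normed_field) topology" where
  "Cp X = subtopology (product_topology (\<lambda>_. euclidean) UNIV)
     {f. continuous_map X euclidean f \<and> (\<forall>x. x \<notin> topspace X \<longrightarrow> f x = 0)}"

lemma topspace_Cp:
  "topspace (Cp X) = {f. continuous_map X euclidean f \<and> (\<forall>x. x \<notin> topspace X \<longrightarrow> f x = 0)}"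
  by (simp add: Cp_def)

lemma continuous_map_Cp_eval: "continuous_map (Cp X) euclidean (\<lambda>f. f x)"
  unfolding Cp_def
  by (intro continuous_map_from_subtopology continuous_map_product_projection) simp

lemma continuous_map_into_Cp:
  "continuous_map Y (Cp X) g \<longleftrightarrow>
     g ` topspace Y \<subseteq> topspace (Cp X) \<and> (\<forall>x. continuous_map Y euclidean (\<lambda>y. g y x))"
  unfolding topspace_Cp unfolding Cp_def
  by (auto simp: continuous_map_in_subtopology continuous_map_componentwise_UNIV image_subset_iff)

lemma continuous_map_mult:
  fixes f g :: "'a \<Rightarrow> 'b::real_normed_algebra"
  shows "\<lbrakk>continuous_map X euclidean f; continuous_map X euclidean g\<rbrakk>
    \<Longrightarrow> continuous_map X euclidean (\<lambda>x. f x * g x)"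
  by (simp add: continuous_map_atin tendsto_mult)

lemma locally_convex_space_Cp:
  fixes X :: "'a topology"
  shows "locally_convex_space (\<lambda>(c::'k::real_normed_field) f x. c * f x) (Cp X)"
proof -
  let ?s = "\<lambda>(c::'k) (f::'a \<Rightarrow> 'k) x. c * f x"
  interpret vs: vector_space ?s
    by unfold_locales (auto simp: fun_eq_iff algebra_simps)
  have sub: "vs.subspace (topspace (Cp X :: ('a \<Rightarrow> 'k) topology))"
    by (rule vs.subspaceI)
       (auto simp: topspace_Cp zero_fun_def plus_fun_def
             intro!: continuous_map_add
                     continuous_map_mult)
  have ev1: "continuous_map (prod_topology Z (Cp X)) euclidean (\<lambda>p. snd p x :: 'k)"
    for Z :: "'z topology" and x
    using continuous_map_compose[OF continuous_map_snd continuous_map_Cp_eval]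
    by (simp add: o_def)
  have ev2: "continuous_map (prod_topology (Cp X) Z) euclidean (\<lambda>p. fst p x :: 'k)"
    for Z :: "'z topology" and x
    using continuous_map_compose[OF continuous_map_fst continuous_map_Cp_eval]
    by (simp add: o_def)
  have add: "continuous_map (prod_topology (Cp X) (Cp X)) (Cp X :: ('a \<Rightarrow> 'k) topology)
      (\<lambda>(f, g). f + g)"
    unfolding continuous_map_into_Cp
    using vs.subspace_add[OF sub]
    by (auto simp: case_prod_unfold intro!: continuous_map_add ev1 ev2)
  have scl: "continuous_map (prod_topology euclidean (Cp X)) (Cp X :: ('a \<Rightarrow> 'k) topology)
      (\<lambda>(c, f). ?s c f)"
    unfolding continuous_map_into_Cp
    using vs.subspace_scale[OF sub]
    by (auto simp: case_prod_unfold intro!: continuous_map_mult ev1 continuous_map_fst)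
  interpret tvs: topological_vector_space ?s "Cp X"
    by unfold_locales (fact sub add scl)+
  show ?thesis
  proof
    fix U :: "('a \<Rightarrow> 'k) set"
    assume "nhd_zero (Cp X) U"
    then obtain V where V: "openin (Cp X) V" "0 \<in> V" "V \<subseteq> U" and U: "U \<subseteq> topspace (Cp X)"
      by (auto simp: nhd_zero_def)
    obtain W where W: "openin (product_topology (\<lambda>_. euclidean) UNIV) W"
      "V = W \<inter> topspace (Cp X)"
      using V(1) unfolding topspace_Cp unfolding Cp_def openin_subtopology by blast
    obtain B where B: "finite {i. B i \<noteq> UNIV}" "\<And>i. open (B i)" "0 \<in> Pi\<^sub>E UNIV B" "Pi\<^sub>E UNIV B \<subseteq> W"
      using product_topology_open_contains_basis[OF W(1), of 0] V(2) W(2) by auto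
    have "\<exists>e>0. ball (0::'k) e \<subseteq> B i" for i
      using B(2)[of i] B(3) by (auto simp: open_contains_ball PiE_iff)
    then obtain e where e: "\<And>i. e i > 0" "\<And>i. ball (0::'k) (e i) \<subseteq> B i"
      by metis
    define I where "I = {i. B i \<noteq> UNIV}"
    define C where "C = {f \<in> topspace (Cp X :: ('a \<Rightarrow> 'k) topology). \<forall>i\<in>I. norm (f i) < e i}"
    have C_eq: "C = topspace (Cp X) \<inter> (\<Inter>i\<in>I. {f \<in> topspace (Cp X). f i \<in> ball 0 (e i)})"
      by (auto simp: C_def)
    have "openin (Cp X) C"
    proof (cases "I = {}")
      case False
      then show ?thesis
        unfolding C_eq using B(1)
        by (intro openin_Int openin_INT2 openin_continuous_map_preimage[OF continuous_map_Cp_eval])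
           (auto simp: I_def)
    qed (simp add: C_eq)
    moreover have "0 \<in> C"
      using vs.subspace_0[OF sub] e(1) by (auto simp: C_def)
    ultimately have "nhd_zero (Cp X) C"
      by (auto simp: nhd_zero_def C_def)
    moreover have "C \<subseteq> U"
    proof
      fix f assume f: "f \<in> C"
      have "f i \<in> B i" for i
        using f e(2)[of i] by (cases "i \<in> I") (auto simp: C_def I_def subset_iff)
      then have "f \<in> W"
        using B(4) by (auto simp: PiE_iff)
      then show "f \<in> U"
        using f W(2) V(3) by (auto simp: C_def)
    qed
    moreover have "?s (of_real (1 - t)) f + ?s (of_real t) g \<in> C"
      if "f \<in> C" "g \<in> C" "t \<in> {0..1}" for f g t
    proof -
      have "norm (of_real (1 - t) * f i + of_real t * g i) < e i" if "i \<in> I" for i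
        using convexD_alt[OF convex_ball, of "f i" 0 "e i" "g i" t]
          \<open>f \<in> C\<close> \<open>g \<in> C\<close> \<open>t \<in> {0..1}\<close> that
        by (simp add: C_def scaleR_conv_of_real)
      then show ?thesis
        using that vs.subspace_add[OF sub vs.subspace_scale[OF sub] vs.subspace_scale[OF sub]]
        by (auto simp: C_def)
    qed
    ultimately show "\<exists>C. nhd_zero (Cp X) C \<and> C \<subseteq> U \<and>
      (\<forall>x\<in>C. \<forall>y\<in>C. \<forall>t\<in>{0..1}. ?s (of_real (1 - t)) x + ?s (of_real t) y \<in> C)"
      by blast
  qed
qed

end

theory Submission
  imports Defs
begin

text \<open>
  In \<open>C\<^sub>p(X)\<close> the precompact sets are exactly the pointwise bounded ones, since a neighborhood
  of zero restricts only finitely many values and bounded sets of scalars are totally bounded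
  (\<open>precompact_in_Cp_iff\<close>).

  If \<open>X\<close> is discrete, then every scalar function on \<open>X\<close> is continuous, so \<open>C\<^sub>p(X)\<close> is a full
  product of copies of the field; a pointwise bounded set lies in a product of closed balls, which
  is compact by Tychonoff's theorem.

  Conversely, the set \<open>A\<close> of the continuous functions bounded by \<open>1\<close> is precompact. If its closure
  in \<open>C\<^sub>p(X)\<close> is compact, then this closure is also closed in the space of all functions,
  which is Hausdorff. So every pointwise limit of members of \<open>A\<close> is continuous.
  As \<open>X\<close> is Tychonoff, members of \<open>A\<close> can be prescribed to be \<open>1\<close> at a point \<open>x\<close> and
  \<open>0\<close> at finitely many other points; therefore the indicator function of \<open>{x}\<close> is such a limit
  (\<open>indicator_in_closure_of_unit_bounded\<close>), and its continuity makes \<open>{x}\<close> open.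
\<close>

section \<open>Precompact sets are the pointwise bounded sets\<close>

lemma nhd_zero_Cp_contains_basic:
  fixes U :: "('a \<Rightarrow> 'k::real_normed_field) set"
  assumes "nhd_zero (Cp X) U"
  shows "\<exists>I e. finite I \<and> (\<forall>i. e i > 0) \<and>
    {f \<in> topspace (Cp X). \<forall>i\<in>I. norm (f i) < e i} \<subseteq> U"
proof -
  obtain V where V: "openin (Cp X) V" "0 \<in> V" "V \<subseteq> U"
    using assms by (auto simp: nhd_zero_def)
  obtain W where W: "openin (product_topology (\<lambda>_. euclidean) UNIV) W" "V = W \<inter> topspace (Cp X)"
    using V(1) unfolding topspace_Cp unfolding Cp_def openin_subtopology by blast
  obtain B where B: "finite {i. B i \<noteq> UNIV}" "\<And>i. open (B i)" "0 \<in> Pi\<^sub>E UNIV B" "Pi\<^sub>E UNIV B \<subseteq> W"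
    using product_topology_open_contains_basis[OF W(1), of 0] V(2) W(2) by auto
  have "\<exists>e>0. ball (0::'k) e \<subseteq> B i" for i
    using B(2)[of i] B(3) by (auto simp: open_contains_ball PiE_iff)
  then obtain e where e: "\<And>i. e i > 0" "\<And>i. ball (0::'k) (e i) \<subseteq> B i"
    by metis
  have "{f \<in> topspace (Cp X). \<forall>i\<in>{i. B i \<noteq> UNIV}. norm (f i) < e i} \<subseteq> U"
  proof
    fix f :: "'a \<Rightarrow> 'k"
    assume f: "f \<in> {f \<in> topspace (Cp X). \<forall>i\<in>{i. B i \<noteq> UNIV}. norm (f i) < e i}"
    have "f i \<in> B i" for i
      using f e(2)[of i] by (cases "B i = UNIV") (auto simp: subset_iff)
    then have "f \<in> W"
      using B(4) by (auto simp: PiE_iff)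
    with f show "f \<in> U"
      using W(2) V(3) by auto
  qed
  with B(1) e(1) show ?thesis
    by blast
qed

lemma nhd_zero_Cp_unit_ball_at:
  "nhd_zero (Cp X) {f \<in> topspace (Cp X). norm (f x :: 'k::real_normed_field) < 1}"
proof -
  have "openin (Cp X) {f \<in> topspace (Cp X). f x \<in> ball (0::'k) 1}"
    by (rule openin_continuous_map_preimage[OF continuous_map_Cp_eval]) auto
  moreover have "0 \<in> topspace (Cp X :: ('a \<Rightarrow> 'k) topology)"
    by (simp add: topspace_Cp zero_fun_def)
  ultimately show ?thesis
    unfolding nhd_zero_def
    by (intro conjI exI[of _ "{f \<in> topspace (Cp X). f x \<in> ball (0::'k) 1}"]) auto
qed

lemma precompact_in_Cp_imp_bounded_at:
  fixes A :: "('a \<Rightarrow> 'k::real_normed_field) set"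
  assumes "precompact_in (Cp X) A"
  shows "bounded ((\<lambda>f. f x) ` A)"
proof -
  obtain F where F: "finite F"
    "A \<subseteq> {f + u | f u. f \<in> F \<and> u \<in> {f \<in> topspace (Cp X). norm (f x) < 1}}"
    using assms nhd_zero_Cp_unit_ball_at[where 'k = 'k and X = X and x = x]
    unfolding precompact_in_def by meson
  have "(\<lambda>f. f x) ` A \<subseteq> (\<Union>f\<in>F. ball (f x) 1)"
    using F(2) by (force simp: dist_norm)
  moreover have "bounded (\<Union>f\<in>F. ball (f x) 1)"
    using F(1) by auto
  ultimately show ?thesis
    by (rule bounded_subset[rotated])
qed

text \<open>
  Only finitely many points \<open>i\<close> matter for a given neighborhood. At each of them the values are
  covered by finitely many balls of radius \<open>e i / 2\<close>, so recording for \<open>f\<close> a ball that contains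
  \<open>f i\<close> sorts the members of \<open>A\<close> into finitely many classes, and one representative of each class
  suffices. The translates must be elements of \<open>C\<^sub>p(X)\<close>, which is why they are taken from
  \<open>A\<close> and not built from the centers.
\<close>
lemma bounded_at_imp_precompact_in_Cp:
  fixes A :: "('a \<Rightarrow> 'k::{real_normed_field, heine_borel}) set"
  assumes A: "A \<subseteq> topspace (Cp X)" and bdd: "\<And>x. bounded ((\<lambda>f. f x) ` A)"
  shows "precompact_in (Cp X) A"
  unfolding precompact_in_def
proof (intro conjI allI impI)
  show "A \<subseteq> topspace (Cp X)"
    by (rule A)
next
  fix U :: "('a \<Rightarrow> 'k) set"
  assume "nhd_zero (Cp X) U"
  from nhd_zero_Cp_contains_basic[OF this] obtain I e
    where I: "finite I" and e: "\<forall>i. e i > 0"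
      and U: "{f \<in> topspace (Cp X). \<forall>i\<in>I. norm (f i) < e i} \<subseteq> U"
    by (elim exE conjE)
  have "\<exists>S. finite S \<and> closure ((\<lambda>f. f i) ` A) \<subseteq> (\<Union>s\<in>S. ball s (e i / 2))" for i
  proof -
    have "compact (closure ((\<lambda>f. f i) ` A))"
      using bdd by simp
    moreover have "e i / 2 > 0"
      using e by simp
    ultimately show ?thesis
      unfolding compact_eq_totally_bounded by blast
  qed
  then obtain S where S: "\<And>i. finite (S i)"
    "\<And>i. closure ((\<lambda>f. f i) ` A) \<subseteq> (\<Union>s\<in>S i. ball s (e i / 2))"
    by metis
  have "\<exists>s\<in>S i. dist s (f i) < e i / 2" if "f \<in> A" for f i
    using S(2)[of i] closure_subset[of "(\<lambda>f. f i) ` A"] that by fastforce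
  then obtain c where c: "\<And>f i. f \<in> A \<Longrightarrow> c f i \<in> S i"
    "\<And>f i. f \<in> A \<Longrightarrow> dist (c f i) (f i) < e i / 2"
    by metis
  define code where "code f = restrict (c f) I" for f
  define F where "F = inv_into A code ` code ` A"
  have "code ` A \<subseteq> Pi\<^sub>E I S"
    using c(1) by (auto simp: code_def)
  then have "finite F"
    unfolding F_def using I S(1) by (meson finite_PiE finite_imageI finite_subset)
  moreover have FA: "F \<subseteq> A"
    by (auto simp: F_def intro: inv_into_into)
  moreover have "A \<subseteq> {f + u | f u. f \<in> F \<and> u \<in> U}"
  proof
    fix f assume f: "f \<in> A"
    define g where "g = inv_into A code (code f)"
    have g: "g \<in> F" "g \<in> A" "code g = code f"
      using f FA by (auto simp: g_def F_def f_inv_into_f)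
    have "f - g \<in> topspace (Cp X)"
      using subsetD[OF A f] subsetD[OF A g(2)]
      by (auto simp: topspace_Cp fun_diff_def intro!: continuous_map_diff)
    moreover have "norm ((f - g) i) < e i" if "i \<in> I" for i
    proof -
      from that g(3) have "c g i = c f i"
        unfolding code_def by (metis restrict_apply')
      with c(2)[OF f, of i] c(2)[OF g(2), of i] have "dist (f i) (g i) < e i"
        by (metis dist_commute dist_triangle_half_r)
      then show ?thesis
        by (simp add: dist_norm)
    qed
    ultimately have "f - g \<in> U"
      using U by blast
    moreover have "f = g + (f - g)"
      by simp
    ultimately show "f \<in> {f + u | f u. f \<in> F \<and> u \<in> U}"
      using g(1) by blast
  qed
  ultimately show "\<exists>F. finite F \<and> F \<subseteq> topspace (Cp X) \<and> A \<subseteq> {f + u | f u. f \<in> F \<and> u \<in> U}"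
    using A by blast
qed

lemma precompact_in_Cp_iff:
  fixes A :: "('a \<Rightarrow> 'k::{real_normed_field, heine_borel}) set"
  shows "precompact_in (Cp X) A \<longleftrightarrow>
    A \<subseteq> topspace (Cp X) \<and> (\<forall>x. bounded ((\<lambda>f. f x) ` A))"
proof (intro iffI conjI allI)
  assume "precompact_in (Cp X) A"
  then show "A \<subseteq> topspace (Cp X)"
    unfolding precompact_in_def by (rule conjunct1)
  show "bounded ((\<lambda>f. f x) ` A)" for x
    using \<open>precompact_in (Cp X) A\<close> by (rule precompact_in_Cp_imp_bounded_at)
next
  assume "A \<subseteq> topspace (Cp X) \<and> (\<forall>x. bounded ((\<lambda>f. f x) ` A))"
  then show "precompact_in (Cp X) A"
    by (intro bounded_at_imp_precompact_in_Cp) simp_all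
qed

section \<open>Discrete spaces\<close>

lemma Hausdorff_space_Cp: "Hausdorff_space (Cp X :: ('a \<Rightarrow> 'k::real_normed_field) topology)"
  unfolding Cp_def by (intro Hausdorff_space_subtopology) (simp add: Hausdorff_space_product_topology)

lemma von_Neumann_complete_Cp_discrete:
  "von_Neumann_complete (Cp (discrete_topology S) :: ('a \<Rightarrow> 'k::{real_normed_field, heine_borel}) topology)"
    (is "von_Neumann_complete ?C")
  unfolding von_Neumann_complete_def
proof (intro allI impI)
  fix A :: "('a \<Rightarrow> 'k) set"
  assume "precompact_in ?C A"
  then have A: "A \<subseteq> topspace ?C" and bdd: "\<And>x. bounded ((\<lambda>f. f x) ` A)"
    by (auto simp: precompact_in_Cp_iff)
  have "\<forall>x. \<exists>b. \<forall>f\<in>A. norm (f x) \<le> b"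
    using bdd unfolding bounded_iff by simp
  then obtain b where b: "\<And>x f. f \<in> A \<Longrightarrow> norm (f x) \<le> b x"
    by metis
  \<comment> \<open>Radius \<open>0\<close> off \<open>S\<close> keeps the product inside the representatives vanishing there.\<close>
  define K where "K = Pi\<^sub>E UNIV (\<lambda>x. cball (0::'k) (if x \<in> S then b x else 0))"
  have K: "compactin ?C K"
    unfolding Cp_def compactin_subtopology K_def
    by (auto simp: compactin_PiE PiE_iff split: if_splits)
  have "A \<subseteq> K"
    using A b by (auto simp: K_def topspace_Cp)
  then have "?C closure_of A \<subseteq> K"
    using K by (intro closure_of_minimal compactin_imp_closedin Hausdorff_space_Cp)
  then show "compactin ?C (?C closure_of A)"
    by (rule closed_compactin[OF K]) (rule closedin_closure_of)
qed

section \<open>Indicators of points as pointwise limits\<close>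

text \<open>
  Complete regularity applied to \<open>x\<close> and the closed set \<open>F \<inter> topspace X - {x}\<close>, which is where the \<open>T\<^sub>1\<close>
  axiom enters: it makes finite sets closed.
\<close>
lemma Tychonoff_space_finite_separation:
  assumes X: "Tychonoff_space X" and x: "x \<in> topspace X" and F: "finite F"
  obtains g :: "'a \<Rightarrow> 'k::real_normed_field" where "g \<in> topspace (Cp X)" "\<And>y. norm (g y) \<le> 1"
    "g x = 1" "\<And>y. \<lbrakk>y \<in> F; y \<noteq> x\<rbrakk> \<Longrightarrow> g y = 0"
proof -
  have "closedin X (F \<inter> topspace X - {x})"
    using X F unfolding Tychonoff_space_def t1_space_closedin_finite
    by (metis Diff_subset finite_Diff finite_Int inf.coboundedI2 inf_commute le_infE subset_trans)
  then obtain f :: "'a \<Rightarrow> real" where f: "continuous_map X (top_of_set {0..1}) f" "f x = 0"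
    "f ` (F \<inter> topspace X - {x}) \<subseteq> {1}"
    using X x unfolding Tychonoff_space_def completely_regular_space_def by blast
  have cont: "continuous_map X euclidean f" and range: "\<And>y. y \<in> topspace X \<Longrightarrow> f y \<in> {0..1}"
    using f(1) by (auto simp: continuous_map_in_subtopology)
  define g where "g y = (if y \<in> topspace X then of_real (1 - f y) else 0 :: 'k)" for y
  have "continuous_map X euclidean (\<lambda>y. of_real (1 - f y) :: 'k)"
    using cont by (auto simp: continuous_map_atin intro!: tendsto_intros)
  then have "continuous_map X euclidean g"
    by (rule continuous_map_eq) (simp add: g_def)
  moreover have "norm (g y) \<le> 1" for y
    unfolding g_def using range[of y] by (auto simp: norm_of_real simp del: of_real_diff)
  ultimately show thesis
    using f(2,3) x by (intro that[of g]) (auto simp: topspace_Cp g_def)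
qed

lemma indicator_in_closure_of_unit_bounded:
  fixes X :: "'a topology"
  assumes X: "Tychonoff_space X" and x: "x \<in> topspace X"
  shows "(\<lambda>y. if y = x then 1 else 0 :: 'k::real_normed_field) \<in>
    product_topology (\<lambda>_. euclidean) UNIV closure_of {f \<in> topspace (Cp X). \<forall>y. norm (f y) \<le> 1}"
    (is "?h \<in> ?P closure_of ?A")
proof -
  have "\<exists>g\<in>?A. g \<in> W" if W: "openin ?P W" "?h \<in> W" for W
  proof -
    obtain B where B: "finite {i. B i \<noteq> UNIV}" "?h \<in> Pi\<^sub>E UNIV B" "Pi\<^sub>E UNIV B \<subseteq> W"
      using product_topology_open_contains_basis[OF W] by auto
    obtain g :: "'a \<Rightarrow> 'k" where g: "g \<in> topspace (Cp X)" "\<And>y. norm (g y) \<le> 1" "g x = 1"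
      "\<And>y. \<lbrakk>y \<in> {i. B i \<noteq> UNIV}; y \<noteq> x\<rbrakk> \<Longrightarrow> g y = 0"
      using Tychonoff_space_finite_separation[OF X x B(1)] by metis
    have "g y = ?h y" if "B y \<noteq> UNIV" for y
      using g(3,4) that by auto
    then have "g y \<in> B y" for y
      using PiE_mem[OF B(2), of y] by (cases "B y = UNIV") auto
    then have "g \<in> W"
      using B(3) by (auto simp: PiE_iff)
    then show ?thesis
      using g(1,2) by blast
  qed
  then show ?thesis
    by (auto simp: in_closure_of)
qed

lemma von_Neumann_complete_Cp_imp_discrete:
  fixes X :: "'a topology"
  assumes X: "Tychonoff_space X"
    and vN: "von_Neumann_complete (Cp X :: ('a \<Rightarrow> 'k::{real_normed_field, heine_borel}) topology)"
      (is "von_Neumann_complete ?C")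
  shows "X = discrete_topology (topspace X)"
proof -
  define A where "A = {f \<in> topspace ?C. \<forall>y. norm (f y) \<le> 1}"
  let ?P = "product_topology (\<lambda>_. euclidean) UNIV :: ('a \<Rightarrow> 'k) topology"
  have "precompact_in ?C A"
    unfolding precompact_in_Cp_iff by (auto simp: A_def bounded_iff)
  then have compact: "compactin ?C (?C closure_of A)"
    using vN by (simp add: von_Neumann_complete_def)
  then have "compactin ?P (?C closure_of A)"
    unfolding Cp_def compactin_subtopology by simp
  then have closed: "closedin ?P (?C closure_of A)"
    by (intro compactin_imp_closedin) (simp_all add: Hausdorff_space_product_topology)
  have "A \<subseteq> ?C closure_of A"
    by (rule closure_of_subset) (auto simp: A_def)
  then have limits: "?P closure_of A \<subseteq> topspace ?C"
    using closure_of_minimal[OF _ closed] compactin_subset_topspace[OF compact] by blast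
  have "openin X {x}" if x: "x \<in> topspace X" for x
  proof -
    let ?h = "\<lambda>y. if y = x then 1 else 0 :: 'k"
    have "?h \<in> topspace ?C"
      using indicator_in_closure_of_unit_bounded[OF X x] limits unfolding A_def by blast
    then have "continuous_map X euclidean ?h"
      unfolding topspace_Cp by blast
    then have "openin X {y \<in> topspace X. ?h y \<in> - {0}}"
      by (rule openin_continuous_map_preimage) auto
    moreover have "{y \<in> topspace X. ?h y \<in> - {0}} = {x}"
      using x by auto
    ultimately show ?thesis
      by simp
  qed
  then show ?thesis
    by (metis discrete_topology_unique)
qed

section \<open>The characterization\<close>

lemma von_Neumann_complete_Cp_iff_discrete:
  fixes X :: "'a topology"
  assumes "Tychonoff_space X"
  shows "von_Neumann_complete (Cp X :: ('a \<Rightarrow> 'k::{real_normed_field, heine_borel}) topology) \<longleftrightarrow>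
    X = discrete_topology (topspace X)"
proof
  assume "X = discrete_topology (topspace X)"
  then show "von_Neumann_complete (Cp X :: ('a \<Rightarrow> 'k) topology)"
    by (rule ssubst) (rule von_Neumann_complete_Cp_discrete)
qed (rule von_Neumann_complete_Cp_imp_discrete[OF assms])

theorem theorem3p13:
  fixes X :: "'a topology"
  assumes "Tychonoff_space X"
  shows "(von_Neumann_complete (Cp X :: ('a \<Rightarrow> real) topology) \<longleftrightarrow> X = discrete_topology (topspace X))
    \<and> (von_Neumann_complete (Cp X :: ('a \<Rightarrow> complex) topology) \<longleftrightarrow> X = discrete_topology (topspace X))"
  using assms by (intro conjI von_Neumann_complete_Cp_iff_discrete)

end
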